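(* Let $K\subset\mathbb{C}$ be a compact set with $0\notin K$. Then there exists $r_0=r_0(K)<\infty$ such that for every sequence $(\phi_n)_{n\ge 0}$ with $\phi_n\in K$ for all $n\ge 0$, the entire function $$f(z)=\sum_{n=0}^\infty \phi_n\frac{z^n}{\sqrt{n!}}$$ has at least one zero in the disk $\{z\in\mathbb{C}: |z|\le r_0\}$.
   Context: The statement is deterministic (no probability is involved). The series defining $f$ converges for all $z\in\mathbb{C}$ because $K$ is bounded. *)

theory Defs
  imports "HOL-Analysis.Analysis"
begin

definition fock_series :: "(nat \<Rightarrow> complex) \<Rightarrow> complex \<Rightarrow> complex" where
  "fock_series \<phi> z = (\<Sum>n. \<phi> n * (z ^ n / of_real (sqrt (fact n))))"

(* For bounded coefficients the series converges everywhere, so suminf is its genuine sum,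
   and the sum is an entire function. *)

lemma summable_power_div_sqrt_fact:
  fixes x :: real
  assumes "x \<ge> 0"
  shows "summable (\<lambda>n. x ^ n / sqrt (fact n))"
proof (rule summable_ratio_test[where c = "1/2" and N = "nat \<lceil>4 * x\<^sup>2\<rceil>"])
  fix n assume "n \<ge> nat \<lceil>4 * x\<^sup>2\<rceil>"
  then have "4 * x\<^sup>2 \<le> real (Suc n)" by linarith
  then have "2 * x \<le> sqrt (real (Suc n))"
    by (intro real_le_rsqrt) (simp add: power_mult_distrib)
  then have le: "x / sqrt (real (Suc n)) \<le> 1/2"
    by (simp add: divide_le_eq)
  have "x ^ Suc n / sqrt (fact (Suc n)) = x / sqrt (real (Suc n)) * (x ^ n / sqrt (fact n))"
    unfolding fact_Suc real_sqrt_mult by simp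
  also have "\<dots> \<le> 1/2 * (x ^ n / sqrt (fact n))"
    using assms by (intro mult_right_mono le) simp
  finally show "norm (x ^ Suc n / sqrt (fact (Suc n))) \<le> 1/2 * norm (x ^ n / sqrt (fact n))"
    using assms by (simp del: fact_Suc power_Suc)
qed simp

lemma summable_fock_series:
  fixes \<phi> :: "nat \<Rightarrow> complex"
  assumes "bounded (range \<phi>)"
  shows "summable (\<lambda>n. \<phi> n * (z ^ n / of_real (sqrt (fact n))))"
proof -
  obtain B where B: "\<And>n. norm (\<phi> n) \<le> B"
    using assms by (auto simp: bounded_iff)
  have "summable (\<lambda>n. B * (norm z ^ n / sqrt (fact n)))"
    by (intro summable_mult summable_power_div_sqrt_fact) simp
  then show ?thesis
  proof (rule summable_comparison_test')
    fix n :: nat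
    have "norm (\<phi> n * (z ^ n / of_real (sqrt (fact n)))) = norm (\<phi> n) * (norm z ^ n / sqrt (fact n))"
      by (simp add: norm_mult norm_divide norm_power)
    also have "\<dots> \<le> B * (norm z ^ n / sqrt (fact n))"
      by (intro mult_right_mono B) simp
    finally show "norm (\<phi> n * (z ^ n / of_real (sqrt (fact n)))) \<le> B * (norm z ^ n / sqrt (fact n))" .
  qed
qed

lemma fock_series_entire:
  assumes "bounded (range \<phi>)"
  shows "fock_series \<phi> holomorphic_on UNIV"
proof -
  let ?c = "\<lambda>n. \<phi> n / of_real (sqrt (fact n))"
  have eq: "fock_series \<phi> = (\<lambda>z. \<Sum>n. ?c n * z ^ n)"
    by (rule ext) (simp add: fock_series_def)
  have "summable (\<lambda>n. ?c n * z ^ n)" for z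
    using summable_fock_series[OF assms, of z] by simp
  then have "((\<lambda>z. \<Sum>n. ?c n * z ^ n) has_field_derivative (\<Sum>n. diffs ?c n * z ^ n)) (at z)" for z
    by (rule termdiffs_strong_converges_everywhere)
  then show ?thesis
    unfolding eq holomorphic_on_open[OF open_UNIV] by blast
qed

end

theory Submission
  imports Defs "HOL-Complex_Analysis.Complex_Analysis"
begin

text \<open>
  If no radius worked, compactness of \<open>K\<^sup>\<nat>\<close> and Hurwitz's theorem would yield coefficients in \<open>K\<close>
  whose series \<open>f\<close> has no zero at all. Since \<open>f\<close> has order at most 2, it is the exponential of a
  quadratic polynomial, so \<open>f' = (b + c z) f\<close>, that is,
  \<open>sqrt (n + 2) \<phi>\<^sub>n\<^sub>+\<^sub>2 = b \<phi>\<^sub>n\<^sub>+\<^sub>1 + c sqrt (n + 1) \<phi>\<^sub>n\<close>. A solution of this recurrence cannot have \<open>|\<phi>\<^sub>n|\<close>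
  bounded and bounded away from 0: this forces \<open>|c| = 1\<close>, and \<open>c = 1\<close> after a rotation. With
  \<open>q\<^sub>n = sqrt (n + 1) \<phi>\<^sub>n\<^sub>+\<^sub>1 cnj \<phi>\<^sub>n = O(sqrt n)\<close> the recurrence reads
  \<open>q\<^sub>n\<^sub>+\<^sub>1 = b |\<phi>\<^sub>n\<^sub>+\<^sub>1|\<^sup>2 + cnj q\<^sub>n\<close>, whose real part forces \<open>Re b = 0\<close>. Finally
  \<open>|\<phi>\<^sub>n\<^sub>+\<^sub>1|\<^sup>2 + |\<phi>\<^sub>n|\<^sup>2 - Im b Im q\<^sub>n / (n + 1)\<close> is bounded but decreases by at least a constant times
  \<open>1 / n\<close> in each step.
\<close>

subsection \<open>Entire functions of finite order without zeros\<close>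

text \<open>Rescale the disk of radius \<open>R = 2 * norm z\<close> to the unit disk. There
  \<open>g - g 0\<close> has real part below \<open>M\<close>, so a Moebius map into the unit disk
  and Schwarz's lemma at a point of modulus 1/2 give \<open>norm (g z - g 0) \<le> 2 * M\<close>,
  where \<open>M\<close> grows like \<open>norm z ^ n\<close>. The restriction
  \<open>1 \<le> norm z\<close> absorbs constants into that power.\<close>

lemma Borel_Caratheodory_polynomial_bound:
  assumes hol: "g holomorphic_on UNIV"
    and re: "\<And>z. Re (g z) \<le> A + B * norm z ^ n" and B: "B \<ge> 0"
  shows "\<exists>C. \<forall>z. 1 \<le> norm z \<longrightarrow> norm (g z) \<le> C * norm z ^ n"
proof -
  \<comment> \<open>The absolute value and the \<open>+ 1\<close> make \<open>M\<close> positive and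
    the bound on \<open>Re (G w)\<close> strict, so the denominator of \<open>h\<close> has no
    zero.\<close>
  define A' where "A' = \<bar>A - Re (g 0)\<bar> + 1"
  define C where "C = norm (g 0) + 2 * (A' + B * 2 ^ n)"
  have "norm (g z) \<le> C * norm z ^ n" if z: "1 \<le> norm z" for z
  proof -
    define R where "R = 2 * norm z"
    define M where "M = A' + B * R ^ n"
    define G where "G = (\<lambda>w. g (of_real R * w) - g 0)"
    define h where "h = (\<lambda>w. G w / (of_real (2 * M) - G w))"
    have R: "R > 0" unfolding R_def using z by linarith
    have "A' > 0" by (simp add: A'_def)
    then have M: "M > 0" using R B unfolding M_def
      by (intro add_pos_nonneg mult_nonneg_nonneg) auto
    have ReG: "Re (G w) < M" if "norm w < 1" for w
    proof -
      have "Re (G w) \<le> A + B * norm (of_real R * w) ^ n - Re (g 0)"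
        using re[of "of_real R * w"] by (simp add: G_def)
      also have "\<dots> \<le> A + B * R ^ n - Re (g 0)"
        using that R B by (intro diff_right_mono add_left_mono mult_left_mono power_mono)
          (auto simp: norm_mult)
      also have "\<dots> < M" by (simp add: M_def A'_def)
      finally show ?thesis .
    qed
    have nz: "of_real (2 * M) - G w \<noteq> 0" if "norm w < 1" for w
      using ReG[OF that] M by (auto simp: complex_eq_iff)
    \<comment> \<open>the half-plane \<open>Re w < M\<close> is mapped into the unit disk by \<open>w \<mapsto> w / (2 M - w)\<close>\<close>
    have lt: "norm (G w) < norm (of_real (2 * M) - G w)" if "norm w < 1" for w
    proof -
      have "(norm (of_real (2 * M) - G w))\<^sup>2 - (norm (G w))\<^sup>2 = 4 * M * (M - Re (G w))"
        unfolding cmod_power2 by (simp add: power2_eq_square algebra_simps)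
      also have "\<dots> > 0" using M ReG[OF that] by simp
      finally show ?thesis using power_less_imp_less_base[of "norm (G w)" 2] by simp
    qed
    have "G holomorphic_on UNIV"
      unfolding G_def
      by (intro holomorphic_intros holomorphic_on_compose_gen[OF _ hol, unfolded o_def]) auto
    then have Ghol: "G holomorphic_on ball 0 1" using holomorphic_on_subset by blast
    have "norm (h (z / of_real R)) \<le> norm (z / of_real R)"
    proof (rule Schwarz_Lemma(1))
      show "h holomorphic_on ball 0 1"
        unfolding h_def by (intro holomorphic_intros Ghol) (use nz in auto)
      show "h 0 = 0" by (simp add: h_def G_def)
      show "norm (h w) < 1" if "norm w < 1" for w
        using lt[OF that] by (simp add: h_def norm_divide divide_less_eq)
      show "norm (z / of_real R) < 1" using z by (simp add: R_def norm_divide norm_mult)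
    qed
    also have "norm (z / of_real R) = 1/2" using R z by (auto simp: R_def norm_divide norm_mult)
    finally have h2: "norm (h (z / of_real R)) \<le> 1/2" .
    have z1: "norm (z / of_real R) < 1" using z by (simp add: R_def norm_divide norm_mult)
    have Gz: "G (z / of_real R) = g z - g 0" using R by (simp add: G_def)
    have "norm (g z - g 0) \<le> 1/2 * norm (of_real (2 * M) - (g z - g 0))"
      using h2 nz[OF z1] unfolding h_def Gz by (simp add: norm_divide divide_le_eq)
    also have "\<dots> \<le> 1/2 * (2 * M + norm (g z - g 0))"
      using norm_triangle_ineq4[of "of_real (2 * M)" "g z - g 0"] M by (simp add: norm_mult)
    finally have "norm (g z - g 0) \<le> 2 * M" by simp
    then have "norm (g z) \<le> norm (g 0) + 2 * M"
      using norm_triangle_sub[of "g z" "g 0"] by linarith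
    also have "\<dots> = (norm (g 0) + 2 * A') * 1 + 2 * (B * 2 ^ n) * norm z ^ n"
      by (simp add: M_def R_def power_mult_distrib algebra_simps)
    also have "\<dots> \<le> (norm (g 0) + 2 * A') * norm z ^ n + 2 * (B * 2 ^ n) * norm z ^ n"
      using z by (intro add_right_mono mult_left_mono one_le_power) (auto simp: A'_def)
    also have "\<dots> = C * norm z ^ n" by (simp add: C_def algebra_simps)
    finally show ?thesis .
  qed
  then show ?thesis by blast
qed

text \<open>A logarithm \<open>g\<close> of \<open>f\<close> has real part bounded quadratically,
  hence is itself bounded quadratically and is a polynomial of degree at most 2. The conclusion is
  the differential equation for \<open>exp g\<close>, since this turns into a recurrence for power
  series coefficients.\<close>

lemma zero_free_order_2_deriv:
  fixes f :: "complex \<Rightarrow> complex"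
  assumes hol: "f holomorphic_on UNIV" and nz: "\<And>z. f z \<noteq> 0"
    and le: "\<And>z. norm (f z) \<le> A * exp (B * (norm z)\<^sup>2)" and B: "B \<ge> 0"
  obtains b c :: complex where "\<And>z. (f has_field_derivative (b + c * z) * f z) (at z)"
proof -
  obtain g where g: "g holomorphic_on UNIV" and eg: "\<And>z. exp (g z) = f z"
    using holomorphic_logarithm_exists[of UNIV f 0] hol nz by auto
  have A: "A > 0" using order.strict_trans2[OF _ le[of 0], of 0] nz[of 0] by simp
  have "Re (g z) \<le> ln A + B * norm z ^ 2" for z
  proof -
    have "exp (Re (g z)) \<le> exp (ln A + B * norm z ^ 2)"
      using le[of z] A by (simp add: eg[symmetric] exp_add)
    then show ?thesis by simp
  qed
  from Borel_Caratheodory_polynomial_bound[OF g this B]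
  obtain C where C: "\<And>z. 1 \<le> norm z \<Longrightarrow> norm (g z) \<le> C * norm z ^ 2" by blast
  define a where "a = (\<lambda>k. (deriv^^k) g 0 / fact k)"
  have "g z = (\<Sum>k\<le>2. a k * z ^ k)" for z
    unfolding a_def by (rule Liouville_polynomial[OF g C])
  then have "f = (\<lambda>z. exp (a 0 + a 1 * z + a 2 * z\<^sup>2))"
    by (auto simp: eg[symmetric] numeral_2_eq_2 fun_eq_iff)
  then have "(f has_field_derivative (a 1 + (2 * a 2) * z) * f z) (at z)" for z
    by (auto intro!: derivative_eq_intros)
  then show ?thesis by (rule that)
qed

subsection \<open>The series with coefficients in an annulus\<close>

text \<open>The square of \<open>(2 * norm z) ^ n / sqrt (fact n)\<close> is a single term of the
  series of \<open>exp (4 * (norm z)\<^sup>2)\<close>. Taking roots leaves a factor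
  \<open>(1/2) ^ n\<close>, so the sum is dominated by a geometric series.\<close>

lemma norm_fock_series_le:
  assumes "\<And>n. norm (\<phi> n) \<le> M"
  shows "norm (fock_series \<phi> z) \<le> 2 * M * exp (2 * (norm z)\<^sup>2)"
proof -
  have M: "M \<ge> 0" using assms[of 0] norm_ge_zero order_trans by blast
  have t: "norm z ^ n / sqrt (fact n) \<le> exp (2 * (norm z)\<^sup>2) * (1/2) ^ n" for n
  proof -
    have "((2 * norm z) ^ n / sqrt (fact n))\<^sup>2 = (4 * (norm z)\<^sup>2) ^ n / fact n"
    proof -
      have "((2 * norm z) ^ n)\<^sup>2 = ((2 * norm z)\<^sup>2) ^ n"
        by (simp only: mult.commute flip: power_mult)
      then show ?thesis by (simp add: power_divide power2_eq_square)
    qed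
    also have "\<dots> \<le> exp (4 * (norm z)\<^sup>2)"
    proof -
      have "(\<Sum>k\<in>{n}. (4 * (norm z)\<^sup>2) ^ k /\<^sub>R fact k) \<le> (\<Sum>k. (4 * (norm z)\<^sup>2) ^ k /\<^sub>R fact k)"
        by (intro sum_le_suminf summable_exp_generic) auto
      then show ?thesis by (simp add: exp_def divide_inverse mult.commute)
    qed
    also have "\<dots> = (exp (2 * (norm z)\<^sup>2))\<^sup>2"
      by (simp add: power2_eq_square flip: exp_add)
    finally have "(2 * norm z) ^ n / sqrt (fact n) \<le> exp (2 * (norm z)\<^sup>2)"
      by (rule power2_le_imp_le) simp
    then show ?thesis by (simp add: power_mult_distrib field_simps)
  qed
  have s: "(\<lambda>n. M * (exp (2 * (norm z)\<^sup>2) * (1/2) ^ n)) sums (M * (exp (2 * (norm z)\<^sup>2) * 2))"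
    using geometric_sums[of "1/2::real"] by (intro sums_mult) simp
  have "norm (fock_series \<phi> z) \<le> (\<Sum>n. M * (exp (2 * (norm z)\<^sup>2) * (1/2) ^ n))"
    unfolding fock_series_def
  proof (rule norm_suminf_le)
    fix n
    have "norm (\<phi> n * (z ^ n / of_real (sqrt (fact n)))) = norm (\<phi> n) * (norm z ^ n / sqrt (fact n))"
      by (simp add: norm_mult norm_divide norm_power)
    also have "\<dots> \<le> M * (exp (2 * (norm z)\<^sup>2) * (1/2) ^ n)"
      by (intro mult_mono assms t M) auto
    finally show "norm (\<phi> n * (z ^ n / of_real (sqrt (fact n)))) \<le> \<dots>" .
  qed (use s in \<open>simp add: sums_iff\<close>)
  also have "\<dots> = 2 * M * exp (2 * (norm z)\<^sup>2)" using s by (simp add: sums_iff)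
  finally show ?thesis .
qed

lemma fock_series_0 [simp]: "fock_series \<phi> 0 = \<phi> 0"
proof -
  have "(\<lambda>n. \<phi> n / of_real (sqrt (fact n)) * 0 ^ n) sums (\<phi> 0 / of_real (sqrt (fact 0)))"
    by (rule powser_sums_zero)
  then show ?thesis by (simp add: fock_series_def sums_iff)
qed

lemma has_fps_expansion_fock_series:
  assumes "bounded (range \<phi>)"
  shows "fock_series \<phi> has_fps_expansion Abs_fps (\<lambda>n. \<phi> n / complex_of_real (sqrt (fact n)))"
proof (rule has_fps_expansionI)
  show "\<forall>\<^sub>F z in nhds 0. (\<lambda>n. fps_nth (Abs_fps (\<lambda>n. \<phi> n / complex_of_real (sqrt (fact n)))) n * z ^ n)
      sums fock_series \<phi> z"
    using summable_fock_series[OF assms] unfolding fock_series_def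
    by (intro always_eventually allI) (auto dest: summable_sums)
qed

lemma fock_series_recurrence:
  fixes \<phi> :: "nat \<Rightarrow> complex" and b c :: complex
  assumes bdd: "bounded (range \<phi>)"
    and der: "\<And>z. (fock_series \<phi> has_field_derivative (b + c * z) * fock_series \<phi> z) (at z)"
  shows "sqrt (real n + 2) * \<phi> (n + 2) = b * \<phi> (n + 1) + c * sqrt (real n + 1) * \<phi> n"
proof -
  define F where "F = Abs_fps (\<lambda>n. \<phi> n / complex_of_real (sqrt (fact n)))"
  have F: "fock_series \<phi> has_fps_expansion F"
    unfolding F_def by (rule has_fps_expansion_fock_series[OF bdd])
  have "deriv (fock_series \<phi>) = (\<lambda>z. (b + c * z) * fock_series \<phi> z)"
    using der DERIV_imp_deriv by blast
  then have "(\<lambda>z. (b + c * z) * fock_series \<phi> z) has_fps_expansion fps_deriv F"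
    using has_fps_expansion_deriv[OF F] by simp
  moreover have "(\<lambda>z. (b + c * z) * fock_series \<phi> z) has_fps_expansion
      (fps_const b + fps_const c * fps_X) * F"
    by (intro fps_expansion_intros F)
  ultimately have "fps_deriv F = (fps_const b + fps_const c * fps_X) * F"
    using fps_expansion_unique_complex by blast
  \<comment> \<open>At index \<open>n + 1\<close> both \<open>b\<close> and \<open>c\<close>
    contribute; multiplying by \<open>sqrt (fact (n + 1))\<close> then clears the
    factorials.\<close>
  then have "fps_nth (fps_deriv F) (n + 1) = fps_nth ((fps_const b + fps_const c * fps_X) * F) (n + 1)"
    by simp
  then have "of_nat (n + 2) * (\<phi> (n + 2) / sqrt (fact (n + 2)))
      = b * (\<phi> (n + 1) / sqrt (fact (n + 1))) + c * (\<phi> n / sqrt (fact n))"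
    by (simp add: F_def distrib_right mult.assoc del: fact_Suc)
  then have eq: "of_real (sqrt (fact (n + 1))) * (of_nat (n + 2) * (\<phi> (n + 2) / sqrt (fact (n + 2))))
      = of_real (sqrt (fact (n + 1))) * (b * (\<phi> (n + 1) / sqrt (fact (n + 1))) + c * (\<phi> n / sqrt (fact n)))"
    by simp
  have f1: "sqrt (fact (n + 1)) = sqrt (real n + 1) * sqrt (fact n)"
    by (simp add: real_sqrt_mult)
  have f2: "sqrt (fact (n + 2)) = sqrt (real n + 2) * sqrt (fact (n + 1))"
    by (simp add: real_sqrt_mult algebra_simps flip: real_sqrt_mult)
  have s: "complex_of_real (sqrt (real n + 2)) * of_real (sqrt (real n + 2)) = of_nat (n + 2)"
    unfolding of_real_mult[symmetric] by simp
  have "of_real (sqrt (fact (n + 1))) * (of_nat (n + 2) * (\<phi> (n + 2) / sqrt (fact (n + 2))))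
      = sqrt (real n + 2) * \<phi> (n + 2)"
    unfolding f2 s[symmetric] by (simp del: fact_Suc add: field_simps)
  moreover have "of_real (sqrt (fact (n + 1))) *
      (b * (\<phi> (n + 1) / sqrt (fact (n + 1))) + c * (\<phi> n / sqrt (fact n)))
      = b * \<phi> (n + 1) + c * sqrt (real n + 1) * \<phi> n"
  proof -
    have "of_real (sqrt (fact (n + 1))) * (b * (\<phi> (n + 1) / sqrt (fact (n + 1)))) = b * \<phi> (n + 1)"
      by (simp del: fact_Suc)
    moreover have "of_real (sqrt (fact (n + 1))) * (c * (\<phi> n / sqrt (fact n))) = c * sqrt (real n + 1) * \<phi> n"
      unfolding f1 by simp
    ultimately show ?thesis by (simp only: distrib_left)
  qed
  ultimately show ?thesis using eq by simp
qed

subsection \<open>The recurrence has no solution in an annulus\<close>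

text \<open>Otherwise, from some index on, every double step changes \<open>norm (x n)\<close> by at
  least \<open>\<delta>\<close>, always in the same direction, and the sequence leaves the
  annulus.\<close>

lemma no_drift_in_annulus:
  fixes x :: "nat \<Rightarrow> complex"
  assumes m: "m > 0" "\<And>n. m \<le> norm (x n)" and M: "\<And>n. norm (x n) \<le> M"
    and lim: "(\<lambda>n. x (n + 2) - c * x n) \<longlonglongrightarrow> 0"
  shows "norm c = 1"
proof (rule ccontr)
  assume "norm c \<noteq> 1"
  \<comment> \<open>Multiplication by \<open>c\<close> changes a modulus of at least
    \<open>m\<close> by at least \<open>2 * \<delta>\<close>; one \<open>\<delta>\<close> is
    reserved for the error term.\<close>
  define \<delta> where "\<delta> = m * \<bar>norm c - 1\<bar> / 2"
  have \<delta>: "\<delta> > 0" using m \<open>norm c \<noteq> 1\<close> by (simp add: \<delta>_def)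
  obtain N where N: "\<And>n. n \<ge> N \<Longrightarrow> norm (x (n + 2) - c * x n) < \<delta>"
    using LIMSEQ_D[OF lim \<delta>] by auto
  obtain k :: nat where k: "M < real k * \<delta>"
    using reals_Archimedean3[OF \<delta>] by blast
  have d: "\<bar>norm (x (n + 2)) - norm c * norm (x n)\<bar> < \<delta>" if "n \<ge> N" for n
    using N[OF that] norm_triangle_ineq3[of "x (n + 2)" "c * x n"] by (simp add: norm_mult)
  show False
  proof (cases "norm c > 1")
    case True
    have step: "norm (x (n + 2)) \<ge> norm (x n) + \<delta>" if "n \<ge> N" for n
    proof -
      have "(norm c - 1) * norm (x n) \<ge> (norm c - 1) * m"
        using True m by (intro mult_left_mono) auto
      also have "(norm c - 1) * m = 2 * \<delta>" using True by (simp add: \<delta>_def)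
      finally show ?thesis using d[OF that] by (simp add: algebra_simps abs_if split: if_splits)
    qed
    have "norm (x (N + 2 * j)) \<ge> real j * \<delta>" for j
    proof (induction j)
      case (Suc j)
      then show ?case using step[of "N + 2 * j"] by (simp add: algebra_simps)
    qed simp
    then show False using k M[of "N + 2 * k"] by (meson not_less order_trans)
  next
    case False
    have step: "norm (x (n + 2)) \<le> norm (x n) - \<delta>" if "n \<ge> N" for n
    proof -
      have "(1 - norm c) * norm (x n) \<ge> (1 - norm c) * m"
        using False m by (intro mult_left_mono) auto
      also have "(1 - norm c) * m = 2 * \<delta>" using False by (simp add: \<delta>_def)
      finally show ?thesis using d[OF that] by (simp add: algebra_simps abs_if split: if_splits)
    qed
    have "norm (x (N + 2 * j)) \<le> M - real j * \<delta>" for j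
    proof (induction j)
      case (Suc j)
      then show ?case using step[of "N + 2 * j"] by (simp add: algebra_simps)
    qed (simp add: M)
    from this[of k] show False using k norm_ge_zero[of "x (N + 2 * k)"] by linarith
  qed
qed

text \<open>After division by \<open>sqrt (real n + 2)\<close> the \<open>b\<close> term vanishes in
  the limit and the ratio of the roots tends to 1, so \<open>\<phi> (n + 2)\<close> is
  asymptotically \<open>c * \<phi> n\<close>.\<close>

lemma recurrence_norm_eq_1:
  fixes \<phi> :: "nat \<Rightarrow> complex" and b c :: complex
  assumes m: "m > 0" "\<And>n. m \<le> norm (\<phi> n)" and M: "\<And>n. norm (\<phi> n) \<le> M"
    and rec: "\<And>n. sqrt (real n + 2) * \<phi> (n + 2) = b * \<phi> (n + 1) + c * sqrt (real n + 1) * \<phi> n"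
  shows "norm c = 1"
proof (rule no_drift_in_annulus[OF m M])
  have eq: "\<phi> (n + 2) - c * \<phi> n = b * of_real (1 / sqrt (real n + 2)) * \<phi> (n + 1)
      + c * of_real (sqrt (real n + 1) / sqrt (real n + 2) - 1) * \<phi> n" for n
  proof -
    have "\<phi> (n + 2) = (sqrt (real n + 2) * \<phi> (n + 2)) / sqrt (real n + 2)"
      by simp
    also have "\<dots> = b * of_real (1 / sqrt (real n + 2)) * \<phi> (n + 1) + c * of_real (sqrt (real n + 1) / sqrt (real n + 2)) * \<phi> n"
      unfolding rec by (simp add: add_divide_distrib)
    finally show ?thesis by (simp add: algebra_simps)
  qed
  have bf: "Bfun (\<lambda>n. \<phi> (n + j)) sequentially" for j
    by (rule BfunI[of _ M]) (simp add: M)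
  have l1: "(\<lambda>n. 1 / sqrt (real n + 2)) \<longlonglongrightarrow> 0" by real_asymp
  have l2: "(\<lambda>n. sqrt (real n + 1) / sqrt (real n + 2) - 1) \<longlonglongrightarrow> 0" by real_asymp
  have z: "(\<lambda>n. a * of_real (u n) * \<phi> (n + j)) \<longlonglongrightarrow> 0" if "u \<longlonglongrightarrow> 0" for a j and u :: "nat \<Rightarrow> real"
  proof -
    have "(\<lambda>n. a * of_real (u n)) \<longlonglongrightarrow> 0"
      using tendsto_mult_right_zero[OF tendsto_of_real[OF that, where 'a=complex, simplified]] by simp
    then have "Zfun (\<lambda>n. a * of_real (u n)) sequentially" by (simp add: tendsto_Zfun_iff)
    from bounded_bilinear.Zfun_prod_Bfun[OF bounded_bilinear_mult this bf]
    show ?thesis by (simp add: tendsto_Zfun_iff)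
  qed
  show "(\<lambda>n. \<phi> (n + 2) - c * \<phi> n) \<longlonglongrightarrow> 0"
    unfolding eq using tendsto_add[OF z[OF l1, of b 1] z[OF l2, of c 0]] by simp
qed

text \<open>Conjugation preserves real parts, so \<open>Re (q n)\<close> moves by
  \<open>Re b * (norm (\<phi> (n + 1)))\<^sup>2\<close> in each step. For
  \<open>Re b \<noteq> 0\<close> this is linear growth in the direction \<open>sgn (Re b)\<close>,
  against a bound of order \<open>sqrt n\<close>.\<close>

lemma recurrence_Re_eq_0:
  fixes \<phi> :: "nat \<Rightarrow> complex" and b c :: complex
  assumes m: "m > 0" "\<And>n. m \<le> norm (\<phi> n)" and M: "\<And>n. norm (\<phi> n) \<le> M"
    and q: "\<And>n. norm (q n) \<le> sqrt (real n + 1) * M\<^sup>2"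
    and qrec: "\<And>n. q (n + 1) = b * of_real ((norm (\<phi> (n + 1)))\<^sup>2) + cnj (q n)"
  shows "Re b = 0"
proof (rule ccontr)
  assume "Re b \<noteq> 0"
  have le: "real n * (\<bar>Re b\<bar> * m\<^sup>2) \<le> sgn (Re b) * (Re (q n) - Re (q 0))" for n
  proof (induction n)
    case (Suc n)
    have "\<bar>Re b\<bar> * m\<^sup>2 \<le> \<bar>Re b\<bar> * (norm (\<phi> (n + 1)))\<^sup>2"
      using m by (intro mult_left_mono power_mono) (auto intro: less_imp_le)
    also have "\<dots> = sgn (Re b) * (Re (q (n + 1)) - Re (q n))"
      unfolding qrec by (simp add: abs_sgn mult.commute)
    finally show ?case using Suc by (simp add: algebra_simps)
  qed simp
  have up: "sgn (Re b) * (Re (q n) - Re (q 0)) \<le> 2 * M\<^sup>2 * sqrt (real n + 1)" for n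
  proof -
    have "sgn (Re b) * (Re (q n) - Re (q 0)) \<le> \<bar>Re (q n)\<bar> + \<bar>Re (q 0)\<bar>"
      by (auto simp: sgn_if)
    also have "\<dots> \<le> sqrt (real n + 1) * M\<^sup>2 + 1 * M\<^sup>2"
      using abs_Re_le_cmod[of "q n"] abs_Re_le_cmod[of "q 0"] q[of n] q[of 0] by simp
    also have "\<dots> \<le> sqrt (real n + 1) * M\<^sup>2 + sqrt (real n + 1) * M\<^sup>2"
      by (intro add_left_mono mult_right_mono) auto
    finally show ?thesis by (simp add: algebra_simps)
  qed
  define d where "d = \<bar>Re b\<bar> * m\<^sup>2"
  have d: "d > 0" using m \<open>Re b \<noteq> 0\<close> by (simp add: d_def)
  have "filterlim (\<lambda>n. real n * d - 2 * M\<^sup>2 * sqrt (real n + 1)) at_top sequentially"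
    using d by real_asymp
  then have "eventually (\<lambda>n. real n * d - 2 * M\<^sup>2 * sqrt (real n + 1) > 0) sequentially"
    unfolding filterlim_at_top_dense by blast
  then obtain n where "real n * d - 2 * M\<^sup>2 * sqrt (real n + 1) > 0"
    by (auto dest: eventually_happens)
  then show False using le[of n] up[of n] unfolding d_def by linarith
qed

text \<open>The quantity \<open>V\<close> below is bounded from below, yet eventually each step
  lowers it by at least \<open>m\<^sup>2 / 2\<close> times \<open>1 / (n + 2)\<close>; the harmonic
  series would have to converge.\<close>

lemma recurrence_normalized_False:
  fixes \<phi> q :: "nat \<Rightarrow> complex"
  assumes m: "m > 0" "\<And>n. m \<le> norm (\<phi> n)" and M: "\<And>n. norm (\<phi> n) \<le> M"
    and rec: "\<And>n. sqrt (real n + 2) * \<phi> (n + 2) = b * \<phi> (n + 1) + sqrt (real n + 1) * \<phi> n"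
  shows False
proof -
  define q where "q = (\<lambda>n. sqrt (real n + 1) * \<phi> (n + 1) * cnj (\<phi> n))"
  define A where "A = (\<lambda>n. (norm (\<phi> n))\<^sup>2)"
  define \<beta> where "\<beta> = Im b"
  define y where "y = (\<lambda>n. Im (q n))"
  have M0: "M \<ge> 0" using M[of 0] norm_ge_zero order_trans by blast
  have qM: "norm (q n) \<le> sqrt (real n + 1) * M\<^sup>2" for n
  proof -
    have "norm (q n) = sqrt (real n + 1) * (norm (\<phi> (n + 1)) * norm (\<phi> n))"
      by (simp add: q_def norm_mult)
    also have "\<dots> \<le> sqrt (real n + 1) * (M * M)"
      by (intro mult_left_mono mult_mono M M0) auto
    finally show ?thesis by (simp add: power2_eq_square)
  qed
  \<comment> \<open>Multiply the recurrence by \<open>cnj (\<phi> (n + 1))\<close>: the last term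
    becomes the conjugate of \<open>q n\<close>.\<close>
  have qrec: "q (n + 1) = b * of_real (A (n + 1)) + cnj (q n)" for n
  proof -
    have "q (n + 1) = (sqrt (real n + 2) * \<phi> (n + 2)) * cnj (\<phi> (n + 1))"
      by (simp add: q_def add.commute)
    also have "\<dots> = b * (\<phi> (n + 1) * cnj (\<phi> (n + 1))) + cnj (q n)"
      unfolding rec q_def by (simp add: algebra_simps)
    finally show ?thesis unfolding A_def complex_norm_square .
  qed
  have "Re b = 0"
    by (rule recurrence_Re_eq_0[OF m M qM qrec[unfolded A_def]])
  then have b: "b = \<i> * of_real \<beta>" by (simp add: \<beta>_def complex_eq_iff)
  have yrec: "y (n + 1) = \<beta> * A (n + 1) - y n" for n
    using qrec[of n] by (simp add: y_def b)
  \<comment> \<open>Take squared moduli in the recurrence. The cross term is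
    \<open>2 * Re (b * q n) = - 2 * \<beta> * y n\<close>, and \<open>yrec\<close> rewrites
    \<open>\<beta>\<^sup>2 * A (n + 1)\<close> as
    \<open>\<beta> * (y (n + 1) + y n)\<close>.\<close>
  have Arec: "(n + 2) * A (n + 2) = (n + 1) * A n + \<beta> * (y (n + 1) - y n)" for n :: nat
  proof -
    have "(n + 2) * A (n + 2) = (norm (sqrt (real n + 2) * \<phi> (n + 2)))\<^sup>2"
      by (simp add: A_def norm_mult power_mult_distrib)
    also have "\<dots> = \<beta>\<^sup>2 * A (n + 1) + (sqrt (real n + 1))\<^sup>2 * A n - 2 * \<beta> * y n"
      unfolding rec b A_def y_def q_def cmod_power2
      by (simp add: power2_eq_square algebra_simps)
    also have "\<dots> = (n + 1) * A n + \<beta> * (y (n + 1) - y n)"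
      unfolding yrec by (simp add: power2_eq_square algebra_simps)
    finally show ?thesis by simp
  qed
  have yM: "\<bar>\<beta> * y n / (n + 1)\<bar> \<le> \<bar>\<beta>\<bar> * M\<^sup>2 / sqrt (real n + 1)" for n :: nat
  proof -
    have "\<bar>y n\<bar> \<le> sqrt (real n + 1) * M\<^sup>2"
      using abs_Im_le_cmod[of "q n"] qM[of n] by (simp add: y_def)
    then have "\<bar>\<beta> * y n / (n + 1)\<bar> \<le> \<bar>\<beta>\<bar> * (sqrt (real n + 1) * M\<^sup>2) / (n + 1)"
      by (simp add: abs_mult divide_right_mono mult_left_mono)
    also have "\<dots> = \<bar>\<beta>\<bar> * M\<^sup>2 * (sqrt (real n + 1) / (n + 1))" by simp
    also have "sqrt (real n + 1) / (n + 1) = 1 / sqrt (real n + 1)"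
      using real_div_sqrt[of "n + 1"] by (simp add: field_simps)
    finally show ?thesis by simp
  qed
  \<comment> \<open>Two neighbouring values of \<open>A\<close> are added because
    \<open>Arec\<close> advances by two. The correction telescopes: the \<open>y\<close> terms in
    the increment, known only to be of order \<open>1 / sqrt n\<close> one by one, combine to
    \<open>\<beta> * y n / ((n + 1) * (n + 2))\<close>, which is negligible against
    \<open>A n / (n + 2)\<close>.\<close>
  define V where "V = (\<lambda>n::nat. A (n + 1) + A n - \<beta> * y n / (n + 1))"
  have Vrec: "V (n + 1) - V n = (\<beta> * y n / (n + 1) - A n) / (n + 2)" for n
  proof -
    have 1: "A (n + 2) = ((n + 1) * A n + \<beta> * (y (n + 1) - y n)) / (n + 2)"
      using Arec[of n] by (simp add: field_simps)
    have "V (n + 1) - V n = A (n + 2) - A n - \<beta> * y (n + 1) / (n + 2) + \<beta> * y n / (n + 1)"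
      by (simp add: V_def add.commute)
    also have "\<dots> = (\<beta> * y n / (n + 1) - A n) / (n + 2)"
      unfolding 1 by (simp add: divide_simps) (simp add: algebra_simps)
    finally show ?thesis .
  qed
  have mA: "m\<^sup>2 \<le> A n" for n using m by (auto simp: A_def intro!: power_mono less_imp_le)
  have Vlow: "V n \<ge> - (\<bar>\<beta>\<bar> * M\<^sup>2)" for n
  proof -
    have "\<bar>\<beta> * y n / (n + 1)\<bar> \<le> \<bar>\<beta>\<bar> * M\<^sup>2 / sqrt (real n + 1)" by (rule yM)
    also have "\<dots> \<le> \<bar>\<beta>\<bar> * M\<^sup>2 / 1"
      by (intro divide_left_mono) auto
    finally have "\<beta> * y n / (n + 1) \<le> \<bar>\<beta>\<bar> * M\<^sup>2"
      using abs_ge_self[of "\<beta> * y n / (n + 1)"] by linarith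
    then show ?thesis
      unfolding V_def using mA[of n] mA[of "n + 1"] zero_le_power2[of m] by linarith
  qed
  have "(\<lambda>n. \<bar>\<beta>\<bar> * M\<^sup>2 / sqrt (real n + 1)) \<longlonglongrightarrow> 0" by real_asymp
  moreover have "m\<^sup>2 / 2 > 0" using m by simp
  ultimately have "eventually (\<lambda>n. \<bar>\<beta>\<bar> * M\<^sup>2 / sqrt (real n + 1) < m\<^sup>2 / 2) sequentially"
    by (rule order_tendstoD(2))
  then obtain N where N: "\<And>n. n \<ge> N \<Longrightarrow> \<bar>\<beta>\<bar> * M\<^sup>2 / sqrt (real n + 1) < m\<^sup>2 / 2"
    by (auto simp: eventually_sequentially)
  have step: "m\<^sup>2 / 2 * inverse (real (n + 2)) \<le> V n - V (n + 1)" if "n \<ge> N" for n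
  proof -
    have eq: "V n - V (n + 1) = (A n - \<beta> * y n / (n + 1)) * inverse (real (n + 2))"
      using Vrec[of n] by (simp add: left_diff_distrib divide_inverse)
    have "A n - \<beta> * y n / (n + 1) \<ge> m\<^sup>2 / 2"
      using N[OF that] yM[of n] mA[of n] by linarith
    then show ?thesis unfolding eq by (rule mult_right_mono) simp
  qed
  have "(\<Sum>k<j. m\<^sup>2 / 2 * inverse (real (k + N + 2))) \<le> V N - V (N + j)" for j
  proof (induction j)
    case (Suc j)
    then show ?case using step[of "N + j"] by (simp add: add_ac)
  qed simp
  moreover have "V N - V (N + j) \<le> V N + \<bar>\<beta>\<bar> * M\<^sup>2" for j using Vlow[of "N + j"] by simp
  ultimately have "(\<Sum>k<j. m\<^sup>2 / 2 * inverse (real (k + N + 2))) \<le> V N + \<bar>\<beta>\<bar> * M\<^sup>2" for j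
    using order_trans by blast
  then have "summable (\<lambda>k. m\<^sup>2 / 2 * inverse (real (k + N + 2)))"
    by (intro summableI_nonneg_bounded) auto
  then have "summable (\<lambda>k. inverse (real (k + (N + 2))))"
    using m by (subst (asm) summable_cmult_iff) (simp add: add.assoc)
  then have "summable (\<lambda>k. inverse (real k))"
    by (subst (asm) summable_iff_shift)
  then show False using not_summable_harmonic by blast
qed

text \<open>Replacing \<open>\<phi> n\<close> by \<open>w ^ n * \<phi> n\<close>, that is
  \<open>f(z)\<close> by \<open>f(w z)\<close>, preserves moduli when \<open>norm w = 1\<close> and
  turns \<open>b\<close>, \<open>c\<close> into \<open>b * w\<close>, \<open>c * w\<^sup>2\<close>.
  Taking \<open>w\<close> as an inverse square root of \<open>c\<close> normalizes \<open>c\<close>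
  to 1.\<close>

lemma recurrence_False:
  fixes \<phi> :: "nat \<Rightarrow> complex" and b c :: complex
  assumes m: "m > 0" "\<And>n. m \<le> norm (\<phi> n)" and M: "\<And>n. norm (\<phi> n) \<le> M"
    and rec: "\<And>n. sqrt (real n + 2) * \<phi> (n + 2) = b * \<phi> (n + 1) + c * sqrt (real n + 1) * \<phi> n"
  shows False
proof -
  have c: "norm c = 1" by (rule recurrence_norm_eq_1[OF m M rec])
  define w where "w = 1 / csqrt c"
  have "norm (w\<^sup>2) = 1" using c by (simp add: w_def power_divide norm_divide)
  then have w: "norm w = 1" by (simp add: norm_power power2_eq_1_iff) (smt (verit) norm_ge_zero)
  have cw: "c * w\<^sup>2 = 1" using c by (auto simp: w_def power_divide)
  define \<psi> where "\<psi> = (\<lambda>n. w ^ n * \<phi> n)"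
  have norm\<psi>: "norm (\<psi> n) = norm (\<phi> n)" for n by (simp add: \<psi>_def norm_mult norm_power w)
  show False
  proof (rule recurrence_normalized_False[of m \<psi> M "b * w"])
    fix n
    have "sqrt (real n + 2) * \<psi> (n + 2) = w ^ (n + 2) * (sqrt (real n + 2) * \<phi> (n + 2))"
      by (simp add: \<psi>_def)
    also have "\<dots> = b * w * \<psi> (n + 1) + (c * w\<^sup>2) * sqrt (real n + 1) * \<psi> n"
      unfolding rec by (simp add: \<psi>_def power2_eq_square algebra_simps)
    finally show "sqrt (real n + 2) * \<psi> (n + 2) = b * w * \<psi> (n + 1) + sqrt (real n + 1) * \<psi> n"
      unfolding cw by simp
  qed (use m M norm\<psi> in auto)
qed

lemma fock_series_has_zero:
  assumes m: "m > 0" "\<And>n. m \<le> norm (\<phi> n)" and M: "\<And>n. norm (\<phi> n) \<le> M"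
  shows "\<exists>z. fock_series \<phi> z = 0"
proof (rule ccontr)
  assume nz: "\<nexists>z. fock_series \<phi> z = 0"
  have bdd: "bounded (range \<phi>)" using M by (auto simp: bounded_iff)
  obtain b c where
    der: "\<And>z. (fock_series \<phi> has_field_derivative (b + c * z) * fock_series \<phi> z) (at z)"
    using zero_free_order_2_deriv[OF fock_series_entire[OF bdd] _ norm_fock_series_le[OF M]] nz
    by auto
  show False
    by (rule recurrence_False[OF m M fock_series_recurrence[OF bdd der]])
qed

subsection \<open>Compactness\<close>

text \<open>On the disk the difference is at most the sum of
  \<open>norm (\<phi> k n - \<phi>' n) * t n\<close>, which is independent of \<open>z\<close> and
  tends to 0 by dominated convergence for series with majorant \<open>2 * M * t n\<close>. For
  negative \<open>R\<close> the disk is empty.\<close>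

lemma uniform_limit_fock_series:
  assumes M: "\<And>k n. norm (\<phi> k n) \<le> M" and lim: "\<And>n. (\<lambda>k. \<phi> k n) \<longlonglongrightarrow> \<phi>' n"
  shows "uniform_limit (cball 0 R) (\<lambda>k. fock_series (\<phi> k)) (fock_series \<phi>') sequentially"
proof (cases "R \<ge> 0")
  case True
  have M': "norm (\<phi>' n) \<le> M" for n
    by (rule Lim_norm_ubound[OF _ lim]) (auto simp: M)
  define t where "t = (\<lambda>n. R ^ n / sqrt (fact n))"
  have t0: "t n \<ge> 0" for n using True by (simp add: t_def)
  have st: "summable t" unfolding t_def by (rule summable_power_div_sqrt_fact[OF True])
  have le2M: "norm (\<phi> k n - \<phi>' n) * t n \<le> 2 * M * t n" for k n
    using norm_triangle_ineq4[of "\<phi> k n" "\<phi>' n"] M[of k n] M'[of n]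
    by (intro mult_right_mono t0) linarith
  have s2: "summable (\<lambda>n. 2 * M * t n)" by (intro summable_mult st)
  have sk: "summable (\<lambda>n. norm (\<phi> k n - \<phi>' n) * t n)" for k
    by (rule summable_comparison_test'[OF s2, of 0]) (use le2M t0 in \<open>simp add: abs_mult\<close>)
  have "(\<lambda>k. \<Sum>n. norm (\<phi> k n - \<phi>' n) * t n) \<longlonglongrightarrow> (\<Sum>n. 0)"
  proof (rule tannerys_theorem[THEN conjunct2, THEN conjunct2])
    show "(\<lambda>k. norm (\<phi> k n - \<phi>' n) * t n) \<longlonglongrightarrow> 0" for n
      using lim[of n] by (intro tendsto_mult_left_zero tendsto_norm_zero) (simp add: LIM_zero_iff)
    show "\<forall>\<^sub>F (n, k) in sequentially \<times>\<^sub>F sequentially. norm (norm (\<phi> k n - \<phi>' n) * t n) \<le> 2 * M * t n"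
      using le2M t0 by (intro always_eventually) (auto simp: abs_mult)
  qed (use s2 in auto)
  then have l0: "(\<lambda>k. \<Sum>n. norm (\<phi> k n - \<phi>' n) * t n) \<longlonglongrightarrow> 0" by simp
  have le: "dist (fock_series (\<phi> k) z) (fock_series \<phi>' z) \<le> (\<Sum>n. norm (\<phi> k n - \<phi>' n) * t n)"
    if "z \<in> cball 0 R" for k z
  proof -
    have b: "bounded (range (\<phi> k))" "bounded (range \<phi>')" using M M' by (auto simp: bounded_iff)
    have "fock_series (\<phi> k) z - fock_series \<phi>' z
        = (\<Sum>n. \<phi> k n * (z ^ n / of_real (sqrt (fact n))) - \<phi>' n * (z ^ n / of_real (sqrt (fact n))))"
      unfolding fock_series_def by (intro suminf_diff summable_fock_series b)
    also have "norm \<dots> \<le> (\<Sum>n. norm (\<phi> k n - \<phi>' n) * t n)"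
    proof (rule norm_suminf_le[OF _ sk])
      fix n
      have "norm (\<phi> k n * (z ^ n / of_real (sqrt (fact n))) - \<phi>' n * (z ^ n / of_real (sqrt (fact n))))
          = norm (\<phi> k n - \<phi>' n) * (norm z ^ n / sqrt (fact n))"
        by (simp add: norm_mult norm_divide norm_power flip: left_diff_distrib diff_divide_distrib)
      also have "\<dots> \<le> norm (\<phi> k n - \<phi>' n) * t n"
        unfolding t_def using that by (intro mult_left_mono divide_right_mono power_mono) auto
      finally show "norm (\<phi> k n * (z ^ n / of_real (sqrt (fact n))) - \<phi>' n * (z ^ n / of_real (sqrt (fact n)))) \<le> \<dots>" .
    qed
    finally show ?thesis by (simp add: dist_norm)
  qed
  show ?thesis
  proof (rule uniform_limitI)
    fix e :: real assume "e > 0"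
    from order_tendstoD(2)[OF l0 this]
    show "\<forall>\<^sub>F k in sequentially. \<forall>z\<in>cball 0 R. dist (fock_series (\<phi> k) z) (fock_series \<phi>' z) < e"
      by eventually_elim (use le order_le_less_trans in blast)
  qed
qed simp

text \<open>This is Tychonoff's theorem: the topology on the function type is the product
  topology.\<close>

lemma compact_sequences:
  fixes K :: "'a::topological_space set"
  assumes "compact K"
  shows "compact {\<phi>::nat \<Rightarrow> 'a. \<forall>n. \<phi> n \<in> K}"
proof -
  have "compactin (product_topology (\<lambda>n::nat. euclidean) UNIV) (PiE UNIV (\<lambda>n. K))"
    using assms by (simp add: compactin_PiE)
  then show ?thesis by (simp add: euclidean_product_topology PiE_UNIV_domain Pi_def)
qed

theorem theorem2:
  fixes K :: "complex set"
  assumes "compact K" and "0 \<notin> K"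
  shows "\<exists>r0::real. \<forall>\<phi>::nat \<Rightarrow> complex. (\<forall>n. \<phi> n \<in> K) \<longrightarrow>
           (\<exists>z\<in>cball 0 r0. fock_series \<phi> z = 0)"
proof (rule ccontr)
  assume "\<not> ?thesis"
  then have "\<forall>r::real. \<exists>\<phi>. (\<forall>n. \<phi> n \<in> K) \<and> (\<forall>z\<in>cball 0 r. fock_series \<phi> z \<noteq> 0)"
    by blast
  then obtain \<Phi> where \<Phi>: "\<And>r n. \<Phi> r n \<in> K"
    and nz: "\<And>r z. z \<in> cball 0 r \<Longrightarrow> fock_series (\<Phi> r) z \<noteq> 0"
    by metis
  obtain M where M: "\<And>x. x \<in> K \<Longrightarrow> norm x \<le> M"
    using compact_imp_bounded[OF assms(1)] by (auto simp: bounded_iff)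
  obtain m where m: "m > 0" "\<And>x. x \<in> K \<Longrightarrow> m \<le> norm x"
    using separate_point_closed[OF compact_imp_closed[OF assms(1)] assms(2)] by auto
  \<comment> \<open>A countable product of first countable spaces is first countable, so compactness
    provides convergent subsequences.\<close>
  have sc: "seq_compact {\<phi>::nat \<Rightarrow> complex. \<forall>n. \<phi> n \<in> K}"
    by (rule compact_imp_seq_compact[OF compact_sequences[OF assms(1)]])
  have "\<forall>k. \<Phi> (real k) \<in> {\<phi>. \<forall>n. \<phi> n \<in> K}" using \<Phi> by simp
  from seq_compactE[OF sc this] obtain \<phi> and s :: "nat \<Rightarrow> nat"
    where "\<phi> \<in> {\<phi>. \<forall>n. \<phi> n \<in> K}" and s: "strict_mono s"
      and lim: "((\<lambda>k. \<Phi> (real k)) \<circ> s) \<longlonglongrightarrow> \<phi>" .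
  then have \<phi>: "\<phi> n \<in> K" for n by simp
  have lim': "(\<lambda>k. \<Phi> (real (s k)) n) \<longlonglongrightarrow> \<phi> n" for n
    using continuous_on_tendsto_compose[OF continuous_on_product_coordinates[of n] lim]
    by (simp add: o_def)
  obtain z0 where z0: "fock_series \<phi> z0 = 0"
    using fock_series_has_zero[of m \<phi> M] m M \<phi> by blast
  \<comment> \<open>Hurwitz's theorem is applied with every \<open>F k\<close> zero-free on
    \<open>S\<close>. Shifting by \<open>k0\<close> ensures this:
    \<open>s (k + k0) \<ge> k0 \<ge> norm z0 + 1\<close>, so the zero-free disk of each
    \<open>F k\<close> contains \<open>S\<close>.\<close>
  define k0 where "k0 = nat \<lceil>norm z0 + 1\<rceil>"
  define S where "S = ball (0::complex) (norm z0 + 1)"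
  define F where "F = (\<lambda>k. fock_series (\<Phi> (real (s (k + k0)))))"
  have bdd: "bounded (range \<psi>)" if "\<And>n. \<psi> n \<in> K" for \<psi> :: "nat \<Rightarrow> complex"
    using M that by (auto simp: bounded_iff)
  have "fock_series \<phi> z0 \<noteq> 0"
  proof (rule Hurwitz_no_zeros[of S F "fock_series \<phi>" z0])
    show "open S" "connected S" "z0 \<in> S" by (auto simp: S_def)
    show "F k holomorphic_on S" for k
      unfolding F_def by (rule holomorphic_on_subset[OF fock_series_entire[OF bdd[OF \<Phi>]]]) simp
    show "fock_series \<phi> holomorphic_on S"
      by (rule holomorphic_on_subset[OF fock_series_entire[OF bdd[OF \<phi>]]]) simp
    show "uniform_limit L F (fock_series \<phi>) sequentially" if "compact L" "L \<subseteq> S" for L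
    proof -
      have "uniform_limit (cball 0 (norm z0 + 1)) F (fock_series \<phi>) sequentially"
        unfolding F_def
        by (rule uniform_limit_fock_series) (use M \<Phi> LIMSEQ_ignore_initial_segment[OF lim'] in auto)
      then show ?thesis by (rule uniform_limit_on_subset) (use that in \<open>auto simp: S_def\<close>)
    qed
    \<comment> \<open>The value at 0 is \<open>\<phi> 0\<close>, an element of \<open>K\<close> and
      hence nonzero, while the value at \<open>z0\<close> is 0.\<close>
    show "\<not> fock_series \<phi> constant_on S"
    proof
      assume "fock_series \<phi> constant_on S"
      moreover have "0 \<in> S" "z0 \<in> S" by (auto simp: S_def add_nonneg_pos)
      ultimately have "fock_series \<phi> 0 = fock_series \<phi> z0" unfolding constant_on_def by metis
      then show False using z0 \<phi>[of 0] assms(2) by simp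
    qed
    show "F k z \<noteq> 0" if "z \<in> S" for k z
    proof -
      have "real k0 \<ge> norm z0 + 1" unfolding k0_def by linarith
      moreover have "s (k + k0) \<ge> k + k0" using s by (rule seq_suble)
      ultimately show ?thesis unfolding F_def using that by (intro nz) (auto simp: S_def)
    qed
  qed
  then show False using z0 by contradiction
qed

end
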